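(* Let $q\in\mathbb{C}$ with $|q|<1$ and let $\chi$ be a primitive Dirichlet character with odd conductor $d\ge1$. Then for every integer $n\ge 0$, $$l_q(-n,\chi)=E_{n,\chi,q}.$$
   Context: Put $[2]_q=1+q$. The generalized $q$-Euler numbers $E_{n,\chi,q}$ are the Taylor coefficients at $t=0$ of $$F_{q,\chi}(t)=\frac{[2]_q\sum_{a=1}^{d}(-1)^aq^a\chi(a)e^{ta}}{q^de^{td}+1}=\sum_{n=0}^\infty E_{n,\chi,q}\frac{t^n}{n!}.$$ For $s\in\mathbb{C}$, the (entire) function $l_q(s,\chi)$ is $$l_q(s,\chi)=[2]_q\sum_{m=1}^\infty\frac{(-1)^mq^m\chi(m)}{m^s}.$$ *)

theory Defs
  imports "HOL-Complex_Analysis.Complex_Analysis" "HOL-Real_Asymp.Real_Asymp"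
begin

definition dirichlet_character :: "nat \<Rightarrow> (int \<Rightarrow> complex) \<Rightarrow> bool" where
  "dirichlet_character N chi \<longleftrightarrow>
     N > 0 \<and>
     (\<forall>a b. chi (a * b) = chi a * chi b) \<and>
     (\<forall>a. chi (a + int N) = chi a) \<and>
     (\<forall>a. chi a \<noteq> 0 \<longleftrightarrow> coprime a (int N))"

definition induced_from_modulus :: "nat \<Rightarrow> (int \<Rightarrow> complex) \<Rightarrow> nat \<Rightarrow> bool" where
  "induced_from_modulus N chi M \<longleftrightarrow>
     M dvd N \<and> (\<exists>\<psi>. dirichlet_character M \<psi> \<and> (\<forall>a. coprime a (int N) \<longrightarrow> chi a = \<psi> a))"

definition conductor :: "nat \<Rightarrow> (int \<Rightarrow> complex) \<Rightarrow> nat" where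
  "conductor N chi = (LEAST M. induced_from_modulus N chi M)"

definition primitive_character :: "nat \<Rightarrow> (int \<Rightarrow> complex) \<Rightarrow> bool" where
  "primitive_character d chi \<longleftrightarrow> dirichlet_character d chi \<and> conductor d chi = d"

definition q_two :: "complex \<Rightarrow> complex" where
  "q_two q = 1 + q"

definition q_Euler_gen :: "complex \<Rightarrow> nat \<Rightarrow> (int \<Rightarrow> complex) \<Rightarrow> complex \<Rightarrow> complex" where
  "q_Euler_gen q d chi t =
     q_two q * (\<Sum>a=1..d. (-1) ^ a * q ^ a * chi (int a) * exp (t * of_nat a)) /
       (q ^ d * exp (t * of_nat d) + 1)"

definition gen_q_Euler :: "nat \<Rightarrow> nat \<Rightarrow> (int \<Rightarrow> complex) \<Rightarrow> complex \<Rightarrow> complex" where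
  "gen_q_Euler n d chi q = fact n * fps_nth (fps_expansion (q_Euler_gen q d chi) 0) n"

text \<open>The series over \<open>m \<ge> 1\<close> is reindexed by \<open>m \<mapsto> Suc m\<close>.  For \<open>\<bar>q\<bar> < 1\<close> and a Dirichlet
  character \<open>chi\<close> it converges for every \<open>s\<close>, so no analytic continuation is involved.\<close>
definition l_q :: "complex \<Rightarrow> complex \<Rightarrow> (int \<Rightarrow> complex) \<Rightarrow> complex" where
  "l_q q s chi =
     q_two q * (\<Sum>m. (-1) ^ Suc m * q ^ Suc m * chi (int (Suc m)) / of_nat (Suc m) powr s)"

lemma dirichlet_character_bounded:
  assumes "dirichlet_character N chi"
  obtains B where "B > 0" "\<And>a. norm (chi a) \<le> B"
proof -
  have per: "chi (a + int N) = chi a" for a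
    using assms by (simp add: dirichlet_character_def)
  have N: "N > 0" using assms by (simp add: dirichlet_character_def)
  have pern: "chi (a + int k * int N) = chi a" for a k
  proof (induction k)
    case (Suc k)
    thus ?case using per[of "a + int k * int N"] by (simp add: algebra_simps)
  qed simp
  have md: "chi a = chi (a mod int N)" for a
  proof (cases "a div int N \<ge> 0")
    case True
    have "chi (a mod int N + int (nat (a div int N)) * int N) = chi (a mod int N)"
      by (rule pern)
    thus ?thesis using True by (simp add: mod_div_mult_eq)
  next
    case False
    have "chi (a + int (nat (- (a div int N))) * int N) = chi a"
      by (rule pern)
    moreover have "a + int (nat (- (a div int N))) * int N = a mod int N"
      using False by (simp add: minus_div_mult_eq_mod)
    ultimately show ?thesis by simp
  qed
  define B where "B = 1 + (\<Sum>b\<in>{0..<int N}. norm (chi b))"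
  have "norm (chi a) \<le> B" for a
  proof -
    have "norm (chi (a mod int N)) \<le> (\<Sum>b\<in>{0..<int N}. norm (chi b))"
      using N by (intro member_le_sum) auto
    thus ?thesis using md[of a] by (simp add: B_def)
  qed
  moreover have "B > 0" unfolding B_def by (intro add_pos_nonneg sum_nonneg) auto
  ultimately show ?thesis using that by blast
qed

lemma summable_l_q:
  assumes q: "norm q < 1" and chi: "dirichlet_character N chi"
  shows "summable (\<lambda>m. norm ((-1) ^ Suc m * q ^ Suc m * chi (int (Suc m)) / of_nat (Suc m) powr s))"
proof -
  obtain B where B: "B > 0" "\<And>a. norm (chi a) \<le> B"
    using dirichlet_character_bounded[OF chi] by blast
  show ?thesis
  proof (cases "q = 0")
    case False
    define r where "r = norm q"
    have r: "0 < r" "r < 1" using False q by (auto simp: r_def)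
    define R where "R = (1 + r) / 2"
    have R: "r < R" "R < 1" "0 < R" using r by (auto simp: R_def)
    have "(\<lambda>m::nat. r ^ m * real (Suc m) powr (- Re s)) \<in> O(\<lambda>m. R ^ m)"
      using r R by real_asymp
    moreover have "summable (\<lambda>m. norm (R ^ m))"
      using R by (simp add: norm_power summable_geometric)
    ultimately have "summable (\<lambda>m. r ^ m * real (Suc m) powr (- Re s))"
      by (rule summable_comparison_test_bigo[rotated])
    hence sm: "summable (\<lambda>m. (B * r) * (r ^ m * real (Suc m) powr (- Re s)))"
      by (rule summable_mult)
    show ?thesis
    proof (rule summable_comparison_test'[OF sm])
      fix m :: nat
      have "norm ((of_nat (Suc m) :: complex) powr s) = real (Suc m) powr Re s"
        using norm_powr_real_powr[of "of_nat (Suc m)" s] by simp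
      hence "norm ((-1) ^ Suc m * q ^ Suc m * chi (int (Suc m)) / of_nat (Suc m) powr s) =
               norm (chi (int (Suc m))) * (r ^ Suc m * real (Suc m) powr (- Re s))"
        by (simp add: norm_mult norm_divide norm_power r_def powr_minus divide_simps
                 del: of_nat_Suc)
      also have "\<dots> \<le> B * (r ^ Suc m * real (Suc m) powr (- Re s))"
        using r B by (intro mult_right_mono) auto
      finally show "norm (norm ((-1) ^ Suc m * q ^ Suc m * chi (int (Suc m)) / of_nat (Suc m) powr s))
                      \<le> (B * r) * (r ^ m * real (Suc m) powr (- Re s))"
        by (simp add: mult_ac)
    qed
  qed simp
qed

lemma q_Euler_gen_sums:
  assumes q: "norm q < 1" and d: "d > 0"
  shows "\<forall>\<^sub>F t in nhds 0. (\<lambda>n. gen_q_Euler n d chi q * t ^ n / fact n) sums q_Euler_gen q d chi t"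
proof -
  have "norm (q ^ d) < 1"
    using q d by (simp add: norm_power power_less_one_iff)
  hence "q ^ d + 1 \<noteq> 0"
    by (metis add_eq_0_iff2 norm_minus_cancel norm_one less_irrefl)
  hence "q_Euler_gen q d chi analytic_on {0}"
    unfolding q_Euler_gen_def by (intro analytic_intros) auto
  hence "q_Euler_gen q d chi has_fps_expansion fps_expansion (q_Euler_gen q d chi) 0"
    using analytic_at_imp_has_fps_expansion_0 by blast
  hence "fps_conv_radius (fps_expansion (q_Euler_gen q d chi) 0) > 0"
    and ev: "\<forall>\<^sub>F t in nhds 0. eval_fps (fps_expansion (q_Euler_gen q d chi) 0) t = q_Euler_gen q d chi t"
    by (auto simp: has_fps_expansion_def)
  hence "\<forall>\<^sub>F t in nhds 0. t \<in> eball 0 (fps_conv_radius (fps_expansion (q_Euler_gen q d chi) 0))"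
    by (intro eventually_nhds_in_open) (auto simp: zero_ereal_def)
  thus ?thesis using ev
  proof eventually_elim
    case (elim t)
    thus ?case
      using sums_eval_fps[of t "fps_expansion (q_Euler_gen q d chi) 0"]
      by (simp add: gen_q_Euler_def)
  qed
qed

end

theory Submission
  imports Defs
begin

text \<open>The coefficients \<open>(-q)\<^sup>m chi(m)\<close> satisfy \<open>a\<^bsub>m+d\<^esub> = -q\<^sup>d a\<^bsub>m\<^esub>\<close> because \<open>d\<close> is odd and
  \<open>chi\<close> has period \<open>d\<close>. Summing over residue blocks therefore gives
  \<open>F(t) = [2]\<^sub>q \<Sum>\<^bsub>m\<ge>1\<^esub> (-q)\<^sup>m chi(m) e\<^bsup>mt\<^esup>\<close>, a power series in \<open>e\<^sup>t\<close> whose radius of convergence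
  exceeds 1. Differentiating \<open>n\<close> times at \<open>t = 0\<close> multiplies the \<open>m\<close>-th term by \<open>m\<^sup>n\<close>.\<close>

text \<open>The operator \<open>x d/dx\<close>, which turns into \<open>d/dt\<close> under the
  substitution \<open>x = exp t\<close>.\<close>

definition fps_euler_op :: "complex fps \<Rightarrow> complex fps" where
  "fps_euler_op f = fps_X * fps_deriv f"

lemma fps_nth_euler_op_power: "fps_nth ((fps_euler_op ^^ k) f) m = of_nat m ^ k * fps_nth f m"
proof (induction k arbitrary: m)
  case (Suc k)
  have "fps_nth (fps_euler_op g) m = of_nat m * fps_nth g m" for g
    by (cases m) (simp_all add: fps_euler_op_def)
  thus ?case by (simp add: Suc)
qed simp

lemma fps_conv_radius_euler_op: "fps_conv_radius (fps_euler_op f) \<ge> fps_conv_radius f"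
  unfolding fps_euler_op_def
  using fps_conv_radius_mult[of fps_X "fps_deriv f"] fps_conv_radius_deriv[of f]
  by (auto intro: order_trans)

lemma fps_conv_radius_euler_op_power:
  "fps_conv_radius ((fps_euler_op ^^ k) f) \<ge> fps_conv_radius f"
  by (induction k) (auto intro: order_trans fps_conv_radius_euler_op)

text \<open>Chain rule: the inner derivative \<open>exp t\<close> is supplied by the factor
  \<open>fps_X\<close> of the operator.\<close>

lemma has_field_derivative_eval_fps_exp:
  assumes "ereal (norm (exp t)) < fps_conv_radius f"
  shows "((\<lambda>t. eval_fps f (exp t)) has_field_derivative eval_fps (fps_euler_op f) (exp t)) (at t)"
proof -
  have "exp t \<in> eball 0 (fps_conv_radius f)"
    using assms by simp
  hence "(eval_fps f has_field_derivative eval_fps (fps_deriv f) (exp t)) (at (exp t))"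
    by (auto intro: has_field_derivative_eval_fps)
  hence "((\<lambda>t. eval_fps f (exp t)) has_field_derivative eval_fps (fps_deriv f) (exp t) * exp t) (at t)"
    by (rule DERIV_chain2) (rule DERIV_exp)
  moreover have "eval_fps (fps_euler_op f) (exp t) = exp t * eval_fps (fps_deriv f) (exp t)"
    unfolding fps_euler_op_def using assms fps_conv_radius_deriv[of f]
    by (subst eval_fps_mult) (auto intro: less_le_trans)
  ultimately show ?thesis by (simp add: mult.commute)
qed

lemma higher_deriv_eval_fps_exp:
  assumes "ereal (norm (exp t)) < fps_conv_radius f"
  shows "(deriv ^^ k) (\<lambda>t. eval_fps f (exp t)) t = eval_fps ((fps_euler_op ^^ k) f) (exp t)"
  using assms
proof (induction k arbitrary: t)
  case (Suc k)
  \<comment> \<open>Differentiating the induction hypothesis requires it on a neighbourhood of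
    \<open>t\<close>, so the condition on \<open>t\<close> is recast as membership in an open
    set.\<close>
  let ?S = "(exp :: complex \<Rightarrow> complex) -` eball 0 (fps_conv_radius f)"
  have "open ?S"
    by (intro open_vimage continuous_on_exp continuous_on_id) auto
  hence "\<forall>\<^sub>F s in nhds t. s \<in> ?S"
    using Suc.prems by (intro eventually_nhds_in_open) auto
  hence "\<forall>\<^sub>F s in nhds t. (deriv ^^ k) (\<lambda>t. eval_fps f (exp t)) s =
           eval_fps ((fps_euler_op ^^ k) f) (exp s)"
    by eventually_elim (auto intro: Suc.IH)
  hence "deriv ((deriv ^^ k) (\<lambda>t. eval_fps f (exp t))) t =
         deriv (\<lambda>s. eval_fps ((fps_euler_op ^^ k) f) (exp s)) t"
    by (rule deriv_cong_ev) simp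
  also have "\<dots> = eval_fps ((fps_euler_op ^^ Suc k) f) (exp t)"
    using has_field_derivative_eval_fps_exp[of t "(fps_euler_op ^^ k) f"]
      Suc.prems fps_conv_radius_euler_op_power[of f k]
    by (auto intro: DERIV_imp_deriv less_le_trans)
  finally show ?case by simp
qed simp

text \<open>The constant coefficient is set to 0 explicitly: \<open>chi 0 = 1\<close> when \<open>d = 1\<close>.\<close>
definition q_Euler_fps :: "complex \<Rightarrow> (int \<Rightarrow> complex) \<Rightarrow> complex fps" where
  "q_Euler_fps q chi =
     Abs_fps (\<lambda>m. if m = 0 then 0 else q_two q * ((-1) ^ m * q ^ m * chi (int m)))"

text \<open>Since \<open>chi\<close> is bounded, a geometric series of ratio
  \<open>norm (q * z)\<close> dominates.\<close>

lemma summable_q_Euler_fps: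
  assumes chi: "dirichlet_character d chi" and qz: "norm (q * z) < 1"
  shows "summable (\<lambda>m. fps_nth (q_Euler_fps q chi) m * z ^ m)"
proof -
  obtain B where B: "B > 0" "\<And>a. norm (chi a) \<le> B"
    using dirichlet_character_bounded[OF chi] by blast
  have "summable (\<lambda>m. norm (q_two q) * B * norm (q * z) ^ m)"
    using qz by (intro summable_mult summable_geometric) simp
  thus ?thesis
  proof (rule summable_comparison_test')
    fix m :: nat
    have "norm (chi (int m)) * (norm (q_two q) * norm (q * z) ^ m) \<le>
          B * (norm (q_two q) * norm (q * z) ^ m)"
      using B by (intro mult_right_mono) auto
    thus "norm (fps_nth (q_Euler_fps q chi) m * z ^ m) \<le> norm (q_two q) * B * norm (q * z) ^ m"
      using B(1)
      by (simp add: q_Euler_fps_def norm_mult norm_power power_mult_distrib mult_ac)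
  qed
qed

text \<open>The strict inequality puts \<open>exp 0 = 1\<close> inside the open disc of convergence,
  where termwise differentiation is allowed.\<close>

lemma fps_conv_radius_q_Euler_fps:
  assumes chi: "dirichlet_character d chi" and q: "norm q < 1"
  shows "fps_conv_radius (q_Euler_fps q chi) > 1"
proof -
  \<comment> \<open>For nonzero \<open>q\<close> this is the harmonic mean of \<open>1\<close> and
    \<open>1 / norm q\<close>, hence strictly between them; the formula also covers
    \<open>q = 0\<close>.\<close>
  define R where "R = 2 / (1 + norm q)"
  have den: "1 + norm q > 0" by (simp add: add_pos_nonneg)
  have R: "R > 1" "norm q * R < 1"
    using q den by (auto simp: R_def field_simps)
  have "summable (\<lambda>m. fps_nth (q_Euler_fps q chi) m * of_real R ^ m)"
    using R by (intro summable_q_Euler_fps[OF chi]) (simp add: norm_mult)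
  hence "fps_conv_radius (q_Euler_fps q chi) \<ge> ereal (norm (of_real R :: complex))"
    unfolding fps_conv_radius_def by (rule conv_radius_geI)
  moreover have "ereal (norm (of_real R :: complex)) > 1"
    using R by simp
  ultimately show ?thesis by (rule less_le_trans[rotated])
qed

text \<open>Splitting off the first \<open>d\<close> terms leaves \<open>- (q * z) ^ d\<close> times
  the whole series, where \<open>z = exp t\<close>; solving this linear equation for the sum gives
  the closed form.\<close>

lemma q_Euler_gen_eq_eval_fps:
  assumes chi: "dirichlet_character d chi" and "odd d" and qt: "norm (q * exp t) < 1"
  shows "q_Euler_gen q d chi t = eval_fps (q_Euler_fps q chi) (exp t)"
proof -
  define z where "z = exp t"
  \<comment> \<open>Index \<open>m\<close> carries exponent \<open>Suc m\<close>, so the initial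
    segment \<open>m < d\<close> is the block \<open>a = 1..d\<close> of the generating
    function.\<close>
  define g where "g m = q_two q * ((-1) ^ Suc m * q ^ Suc m * chi (int (Suc m))) * z ^ Suc m" for m
  have per: "chi (a + int d) = chi a" for a
    using chi by (simp add: dirichlet_character_def)
  have d: "d > 0"
    using chi by (simp add: dirichlet_character_def)
  have sum0: "summable (\<lambda>m. fps_nth (q_Euler_fps q chi) m * z ^ m)"
    using summable_q_Euler_fps[OF chi qt] by (simp add: z_def)
  have g_eq: "(\<lambda>m. fps_nth (q_Euler_fps q chi) (Suc m) * z ^ Suc m) = g"
    by (simp add: fun_eq_iff q_Euler_fps_def g_def)
  have summ: "summable g"
    using sum0 by (subst (asm) summable_Suc_iff[symmetric]) (simp only: g_eq)
  have eval: "eval_fps (q_Euler_fps q chi) z = suminf g"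
    unfolding eval_fps_def using suminf_split_head[OF sum0] g_eq
    by (simp add: q_Euler_fps_def)
  \<comment> \<open>The minus sign is \<open>(-1) ^ d\<close> for odd \<open>d\<close>.\<close>
  have shift: "g (m + d) = - (q ^ d * z ^ d) * g m" for m
    using per[of "int (Suc m)"] \<open>odd d\<close>
    by (simp add: g_def power_add add_ac mult_ac)
  have "suminf g = (\<Sum>m. g (m + d)) + (\<Sum>m<d. g m)"
    by (rule suminf_split_initial_segment[OF summ])
  also have "(\<Sum>m. g (m + d)) = - (q ^ d * z ^ d) * suminf g"
    unfolding shift by (rule suminf_mult[OF summ])
  also have "(\<Sum>m<d. g m) =
      (\<Sum>a=1..d. q_two q * ((-1) ^ a * q ^ a * chi (int a)) * z ^ a)"
    by (rule sum.reindex_bij_witness[of _ "\<lambda>a. a - 1" Suc]) (auto simp: g_def)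
  also have "\<dots> = q_two q * (\<Sum>a=1..d. (-1) ^ a * q ^ a * chi (int a) * exp (t * of_nat a))"
    by (simp add: sum_distrib_left z_def exp_of_nat2_mult mult_ac)
  finally have "(q ^ d * z ^ d + 1) * suminf g =
      q_two q * (\<Sum>a=1..d. (-1) ^ a * q ^ a * chi (int a) * exp (t * of_nat a))"
    by (simp add: algebra_simps)
  moreover have "q ^ d * z ^ d + 1 \<noteq> 0"
  proof
    assume "q ^ d * z ^ d + 1 = 0"
    hence "(q * z) ^ d = -1" by (simp add: power_mult_distrib add_eq_0_iff2)
    hence "norm (q * z) ^ d = 1" by (metis norm_power norm_minus_cancel norm_one)
    moreover have "norm (q * z) ^ d < 1"
      using qt d by (simp add: z_def power_less_one_iff)
    ultimately show False by simp
  qed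
  ultimately have "suminf g = q_Euler_gen q d chi t"
    by (simp add: q_Euler_gen_def z_def exp_of_nat2_mult eq_divide_eq mult_ac)
  thus ?thesis using eval by (simp add: z_def)
qed

lemma l_q_neg_of_nat_eq_eval_fps:
  assumes chi: "dirichlet_character d chi" and q: "norm q < 1"
  shows "l_q q (- of_nat n) chi = eval_fps ((fps_euler_op ^^ n) (q_Euler_fps q chi)) 1"
proof -
  let ?f = "(fps_euler_op ^^ n) (q_Euler_fps q chi)"
  have "fps_conv_radius ?f > 1"
    using fps_conv_radius_q_Euler_fps[OF assms] fps_conv_radius_euler_op_power
    by (rule less_le_trans)
  hence summ: "summable (\<lambda>m. fps_nth ?f m * 1 ^ m)"
    by (intro summable_fps) (simp add: one_ereal_def)
  have summ_l: "summable (\<lambda>m. (-1) ^ Suc m * q ^ Suc m * chi (int (Suc m)) /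
                   of_nat (Suc m) powr (- of_nat n))"
    by (rule summable_norm_cancel[OF summable_l_q[OF q chi]])
  \<comment> \<open>The head term vanishes even for \<open>n = 0\<close>, where
    \<open>0 ^ n = 1\<close>, because the constant coefficient of \<open>q_Euler_fps\<close> is
    0.\<close>
  have "eval_fps ?f 1 = (\<Sum>m. fps_nth ?f (Suc m))"
    unfolding eval_fps_def using suminf_split_head[OF summ]
    by (simp add: fps_nth_euler_op_power q_Euler_fps_def)
  also have "\<dots> = (\<Sum>m. q_two q * ((-1) ^ Suc m * q ^ Suc m * chi (int (Suc m)) /
                   of_nat (Suc m) powr (- of_nat n)))"
  proof (intro suminf_cong)
    fix m
    have "(of_nat (Suc m) :: complex) powr (- of_nat n) = inverse (of_nat (Suc m) ^ n)"
      by (subst powr_minus, subst powr_nat') (auto simp del: of_nat_Suc)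
    thus "fps_nth ?f (Suc m) = q_two q * ((-1) ^ Suc m * q ^ Suc m * chi (int (Suc m)) /
                   of_nat (Suc m) powr (- of_nat n))"
      by (simp add: fps_nth_euler_op_power q_Euler_fps_def divide_inverse mult_ac del: of_nat_Suc)
  qed
  also have "\<dots> = l_q q (- of_nat n) chi"
    unfolding l_q_def by (rule suminf_mult[OF summ_l])
  finally show ?thesis ..
qed

theorem theorem6:
  fixes q :: complex and chi :: "int \<Rightarrow> complex" and d n :: nat
  assumes "norm q < 1"
    and "d \<ge> 1" and "odd d"
    and "primitive_character d chi"
  shows "l_q q (- of_nat n) chi = gen_q_Euler n d chi q"
proof -
  have chi: "dirichlet_character d chi"
    using assms by (simp add: primitive_character_def)
  \<comment> \<open>The region contains 0 because \<open>norm q < 1\<close>. The two functions thus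
    agree near 0, so all their derivatives there coincide.\<close>
  have "open {t. norm (q * exp t) < 1}"
    by (intro open_Collect_less continuous_intros)
  hence "\<forall>\<^sub>F t in nhds 0. t \<in> {t. norm (q * exp t) < 1}"
    using assms(1) by (intro eventually_nhds_in_open) auto
  hence ev: "\<forall>\<^sub>F t in nhds 0. q_Euler_gen q d chi t = eval_fps (q_Euler_fps q chi) (exp t)"
    by eventually_elim (use q_Euler_gen_eq_eval_fps[OF chi \<open>odd d\<close>] in auto)
  have "gen_q_Euler n d chi q = (deriv ^^ n) (q_Euler_gen q d chi) 0"
    by (simp add: gen_q_Euler_def fps_expansion_def)
  also have "\<dots> = (deriv ^^ n) (\<lambda>t. eval_fps (q_Euler_fps q chi) (exp t)) 0"
    by (rule higher_deriv_cong_ev[OF ev]) simp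
  also have "\<dots> = eval_fps ((fps_euler_op ^^ n) (q_Euler_fps q chi)) 1"
    using higher_deriv_eval_fps_exp[of 0 "q_Euler_fps q chi" n]
      fps_conv_radius_q_Euler_fps[OF chi assms(1)] by (simp add: one_ereal_def)
  also have "\<dots> = l_q q (- of_nat n) chi"
    using l_q_neg_of_nat_eq_eval_fps[OF chi assms(1)] ..
  finally show ?thesis ..
qed

end
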